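(* Let $f^1:\mathbb{F}_2^d\to\mathbb{F}_2$ and, for $k\ge 2$, let $f^k:\mathbb{F}_2^{d^k}\to\mathbb{F}_2$ be defined by $f^k=f^1\big(\hat f^{k-1}_1,\dots,\hat f^{k-1}_d\big)$, where the $j$-th argument $\hat f^{k-1}_j$ is either $f^{k-1}$ or its complement $\overline{f^{k-1}}$, applied to the $j$-th block of $d^{k-1}$ consecutive variables. Suppose $\mathrm{pdeg}(f^k)<d^k$ for all $k$. Then there is no function $t:\mathbb{N}\to\mathbb{N}$ with $t(m)\to\infty$ such that $f^k$ is $t(d^k)$-th order sensitive for every $k$.
   Context: $\mathrm{pdeg}$ is the real polynomial degree. For $S\subseteq[n]$, $\mathbf{x}^{(S)}$ is $\mathbf{x}$ with the bits in $S$ flipped; $h$ is $k$-th order sensitive if there is $\mathbf{x}$ with $h(\mathbf{x})\ne h(\mathbf{x}^{(S)})$ for all $S$ with $1\le|S|\le k$. *)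

theory Defs
  imports Complex_Main "HOL-Library.Z2"
begin

text \<open>
  A point of the cube of dimension n over the field with two elements is a list over
  \<^typ>\<open>bit\<close> of length n. A Boolean function of n variables is a function on lists of which only the
  values on \<open>cube n\<close> matter. Coordinates are numbered from 0 to n - 1.
\<close>

definition cube :: "nat \<Rightarrow> bit list set" where
  "cube n = {x. length x = n}"

definition flip_bits :: "bit list \<Rightarrow> nat set \<Rightarrow> bit list" where
  "flip_bits x S = map (\<lambda>i. if i \<in> S then x ! i + 1 else x ! i) [0..<length x]"

text \<open>
  Every function is sensitive of order 0. When d = 1, all functions of the iterated sequence are
  functions of one variable, so a bound t on their order of sensitivity says something only if t 1
  is positive.
\<close>

definition order_sensitive :: "nat \<Rightarrow> nat \<Rightarrow> (bit list \<Rightarrow> bit) \<Rightarrow> bool" where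
  "order_sensitive n k h \<longleftrightarrow>
     (\<exists>x \<in> cube n. \<forall>S \<subseteq> {..<n}. 1 \<le> card S \<and> card S \<le> k \<longrightarrow> h x \<noteq> h (flip_bits x S))"

text \<open>
  A real multilinear polynomial in n variables is given by its coefficients \<open>c S\<close>, the coefficient
  of the monomial \<open>\<Prod>i\<in>S. x\<^sub>i\<close>, which vanish unless \<open>S \<subseteq> {..<n}\<close>.
\<close>

definition multilinear_rep :: "nat \<Rightarrow> (bit list \<Rightarrow> bit) \<Rightarrow> (nat set \<Rightarrow> real) \<Rightarrow> bool" where
  "multilinear_rep n h c \<longleftrightarrow>
     (\<forall>S. \<not> S \<subseteq> {..<n} \<longrightarrow> c S = 0) \<and>
     (\<forall>x \<in> cube n. (of_bit (h x) :: real) = (\<Sum>S \<in> Pow {..<n}. c S * (\<Prod>i\<in>S. of_bit (x ! i))))"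

definition real_coeffs :: "nat \<Rightarrow> (bit list \<Rightarrow> bit) \<Rightarrow> nat set \<Rightarrow> real" where
  "real_coeffs n h = (THE c. multilinear_rep n h c)"

text \<open>The zero polynomial gets degree 0.\<close>

definition pdeg :: "nat \<Rightarrow> (bit list \<Rightarrow> bit) \<Rightarrow> nat" where
  "pdeg n h = Max (insert 0 (card ` {S. real_coeffs n h S \<noteq> 0}))"

definition complement_fun :: "(bit list \<Rightarrow> bit) \<Rightarrow> bit list \<Rightarrow> bit" where
  "complement_fun h = (\<lambda>x. h x + 1)"

definition block :: "nat \<Rightarrow> bit list \<Rightarrow> nat \<Rightarrow> bit list" where
  "block m x j = take m (drop (j * m) x)"

text \<open>
  The sequence \<open>f 1, f 2, \<dots>\<close> arises from \<open>f 1\<close> by iterated composition; which arguments are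
  complemented may depend on the level k and on the position j. The value \<open>f 0\<close> plays no role.
\<close>

definition iterated_composition :: "nat \<Rightarrow> (nat \<Rightarrow> bit list \<Rightarrow> bit) \<Rightarrow> bool" where
  "iterated_composition d f \<longleftrightarrow>
     (\<forall>k \<ge> 2. \<exists>g. (\<forall>j<d. g j = f (k - 1) \<or> g j = complement_fun (f (k - 1))) \<and>
       (\<forall>x \<in> cube (d ^ k). f k x = f 1 (map (\<lambda>j. g j (block (d ^ (k - 1)) x j)) [0..<d])))"

text \<open>Every Boolean function has exactly one multilinear representation.\<close>

lemma multilinear_eval:
  assumes "x \<in> cube n"
  shows "(\<Sum>S \<in> Pow {..<n}. c S * (\<Prod>i\<in>S. (of_bit (x ! i) :: real)))
    = (\<Sum>S \<in> Pow {i. i < n \<and> x ! i = 1}. c S)"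
proof -
  let ?T = "{i. i < n \<and> x ! i = 1}"
  have m: "(\<Prod>i\<in>S. (of_bit (x ! i) :: real)) = of_bool (S \<subseteq> ?T)" if "S \<subseteq> {..<n}" for S
  proof (cases "S \<subseteq> ?T")
    case True
    then have "(\<Prod>i\<in>S. (of_bit (x ! i) :: real)) = (\<Prod>i\<in>S. 1)"
      by (intro prod.cong) auto
    with True show ?thesis by simp
  next
    case False
    then obtain i where "i \<in> S" "i \<notin> ?T" unfolding subset_iff by blast
    then have i: "i \<in> S" "x ! i = 0" using that by auto
    have "finite S" using finite_subset[OF that] by simp
    moreover have "(of_bit (x ! i) :: real) = 0" using i by simp
    ultimately have "(\<Prod>i\<in>S. (of_bit (x ! i) :: real)) = 0"
      using i(1) by (intro prod_zero bexI[of _ i])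
    with False show ?thesis by simp
  qed
  have "(\<Sum>S \<in> Pow {..<n}. c S * (\<Prod>i\<in>S. (of_bit (x ! i) :: real)))
      = (\<Sum>S \<in> Pow {..<n}. if S \<subseteq> ?T then c S else 0)"
    by (intro sum.cong refl) (simp only: Pow_iff m, simp)
  also have "\<dots> = (\<Sum>S \<in> Pow {..<n} \<inter> {S. S \<subseteq> ?T}. c S)"
    by (simp add: sum.inter_restrict)
  also have "Pow {..<n} \<inter> {S. S \<subseteq> ?T} = Pow ?T" by auto
  finally show ?thesis .
qed

lemma multilinear_rep_iff:
  "multilinear_rep n h c \<longleftrightarrow>
     (\<forall>S. \<not> S \<subseteq> {..<n} \<longrightarrow> c S = 0) \<and>
     (\<forall>T \<subseteq> {..<n}. (of_bit (h (map (\<lambda>i. of_bool (i \<in> T)) [0..<n])) :: real) = sum c (Pow T))"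
    (is "_ \<longleftrightarrow> ?A \<and> ?B")
proof -
  have "(\<forall>x \<in> cube n. (of_bit (h x) :: real)
      = (\<Sum>S \<in> Pow {..<n}. c S * (\<Prod>i\<in>S. of_bit (x ! i)))) \<longleftrightarrow> ?B" (is "?C \<longleftrightarrow> ?B")
  proof
    assume C: ?C
    show ?B
    proof (intro allI impI)
      fix T assume T: "T \<subseteq> {..<n}"
      let ?x = "map (\<lambda>i. of_bool (i \<in> T)) [0..<n] :: bit list"
      have x: "?x \<in> cube n" by (simp add: cube_def)
      have "{i. i < n \<and> ?x ! i = 1} = T" using T by auto
      with C[rule_format, OF x] multilinear_eval[OF x, of c]
      show "(of_bit (h ?x) :: real) = sum c (Pow T)" by simp
    qed
  next
    assume B: ?B
    show ?C
    proof
      fix x assume x: "x \<in> cube n"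
      let ?T = "{i. i < n \<and> x ! i = 1}"
      have "map (\<lambda>i. of_bool (i \<in> ?T)) [0..<n] = x"
        using x by (intro nth_equalityI) (auto simp: cube_def)
      moreover have "?T \<subseteq> {..<n}" by auto
      ultimately have "(of_bit (h x) :: real) = sum c (Pow ?T)"
        using B[rule_format, of ?T] by (simp only:)
      then show "(of_bit (h x) :: real)
          = (\<Sum>S \<in> Pow {..<n}. c S * (\<Prod>i\<in>S. of_bit (x ! i)))"
        by (simp only: multilinear_eval[OF x])
    qed
  qed
  then show ?thesis unfolding multilinear_rep_def by blast
qed

lemma multilinear_rep_ex1: "\<exists>!c. multilinear_rep n h c"
proof (rule ex_ex1I)
  define v where "v T = (of_bit (h (map (\<lambda>i. of_bool (i \<in> T)) [0..<n])) :: real)" for T :: "nat set"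
  define e where "e S = (\<Sum>T \<in> Pow S. (- 1) ^ card T * v T)" for S :: "nat set"
  define c where "c S = (if S \<subseteq> {..<n} then (- 1) ^ card S * e S else 0)" for S :: "nat set"
  have "v T = sum c (Pow T)" if "T \<subseteq> {..<n}" for T
  proof -
    have "finite T" using finite_subset[OF that] by simp
    then have "v T = (\<Sum>S \<in> Pow T. (- 1) ^ card S * e S)"
      by (rule inclusion_exclusion_symmetric[rotated]) (simp only: e_def)
    also have "\<dots> = sum c (Pow T)"
      using that by (intro sum.cong) (auto simp: c_def)
    finally show ?thesis .
  qed
  then have "multilinear_rep n h c"
    unfolding multilinear_rep_iff by (simp add: v_def c_def)
  then show "\<exists>c. multilinear_rep n h c" by (rule exI[of _ c])
next
  fix c c'
  assume c: "multilinear_rep n h c" and c': "multilinear_rep n h c'"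
  have "c S = c' S" if "finite S" "S \<subseteq> {..<n}" for S
    using that
  proof (induction S rule: finite_psubset_induct)
    case (psubset S)
    have "sum c (Pow S) = sum c' (Pow S)"
      using c[unfolded multilinear_rep_iff, THEN conjunct2, rule_format, OF psubset.prems]
        c'[unfolded multilinear_rep_iff, THEN conjunct2, rule_format, OF psubset.prems] by linarith
    moreover have "sum c (Pow S - {S}) = sum c' (Pow S - {S})"
    proof (rule sum.cong[OF refl])
      fix T assume "T \<in> Pow S - {S}"
      then have "T \<subset> S" by auto
      with psubset.prems show "c T = c' T" by (intro psubset.IH) auto
    qed
    moreover have "finite (Pow S)" "S \<in> Pow S" using psubset.hyps by simp_all
    ultimately show "c S = c' S"
      using sum.remove[of "Pow S" S c] sum.remove[of "Pow S" S c'] by linarith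
  qed
  moreover have "c S = c' S" if "\<not> S \<subseteq> {..<n}" for S
    using c c' that unfolding multilinear_rep_iff by simp
  ultimately show "c = c'"
    using finite_subset[OF _ finite_lessThan, of _ n] by (intro ext) metis
qed

end

theory Submission
  imports Defs
begin

text \<open>
  A function of degree less than the number d of variables is not a point function or the
  complement of one, so at every point y there is a nonempty set S of coordinates whose flip
  preserves \<open>f 1 y\<close>. If \<open>f k\<close> is sensitive of order at least 1 at x, then flipping the first
  variable of a block must change the value of that block. Flipping the first variable of
  every block in S therefore flips exactly the arguments of \<open>f 1\<close> in S and preserves \<open>f k x\<close>. So
  for \<open>k \<ge> 2\<close> no \<open>f k\<close> is sensitive of order d.
\<close>

lemma length_flip_bits [simp]: "length (flip_bits x S) = length x"
  by (simp add: flip_bits_def)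

lemma nth_flip_bits [simp]:
  "i < length x \<Longrightarrow> flip_bits x S ! i = (if i \<in> S then x ! i + 1 else x ! i)"
  by (simp add: flip_bits_def)

lemma flip_bits_empty [simp]: "flip_bits x {} = x"
  by (intro nth_equalityI) auto

lemma bit_noteq_iff: "a \<noteq> b \<longleftrightarrow> b = a + 1" for a b :: bit
  by (cases a; cases b) auto

lemma multilinear_rep_real_coeffs: "multilinear_rep n h (real_coeffs n h)"
  unfolding real_coeffs_def by (rule theI'[OF multilinear_rep_ex1])

text \<open>Moebius inversion on the subset lattice: at the indicator vector of \<open>T\<close>,
  the value of \<open>h\<close> is the sum of \<open>c\<close> over all subsets of
  \<open>T\<close>.\<close>

lemma multilinear_rep_top_coeff:
  assumes "multilinear_rep n h c"
  shows "(- 1) ^ n * c {..<n} =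
    (\<Sum>T \<in> Pow {..<n}. (- 1) ^ card T * of_bit (h (map (\<lambda>i. of_bool (i \<in> T)) [0..<n])))"
proof -
  \<comment> \<open>The sign put into \<open>f\<close> cancels the sign in the inversion formula,
    leaving plain subset sums of \<open>c\<close>.\<close>
  have "(- 1) ^ card {..<n} * c {..<n} = (\<Sum>T \<in> Pow {..<n}. (- 1) ^ card T * sum c (Pow T))"
    by (rule inclusion_exclusion_symmetric[where f = "\<lambda>S. (- 1) ^ card S * c S"])
      (simp_all add: mult.assoc[symmetric] power_mult_distrib[symmetric])
  also have "\<dots> = (\<Sum>T \<in> Pow {..<n}. (- 1) ^ card T *
      of_bit (h (map (\<lambda>i. of_bool (i \<in> T)) [0..<n])))"
    using assms unfolding multilinear_rep_iff by (intro sum.cong) simp_all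
  finally show ?thesis by simp
qed

lemma real_coeffs_top_eq_0:
  assumes "pdeg n h < n"
  shows "real_coeffs n h {..<n} = 0"
proof (rule ccontr)
  assume "real_coeffs n h {..<n} \<noteq> 0"
  then have "card {..<n} \<in> card ` {S. real_coeffs n h S \<noteq> 0}" by blast
  \<comment> \<open>\<open>Max\<close> bounds its elements only on a finite set, so the support must
    be finite.\<close>
  moreover have "{S. real_coeffs n h S \<noteq> 0} \<subseteq> Pow {..<n}"
    using multilinear_rep_real_coeffs[of n h] by (auto simp: multilinear_rep_def)
  then have "finite {S. real_coeffs n h S \<noteq> 0}"
    by (rule finite_subset) simp
  ultimately have "n \<le> pdeg n h"
    unfolding pdeg_def by (intro Max_ge) auto
  with assms show False by simp
qed

text \<open>Inversion for the indicator of the empty set, whose signed subset sums are all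
  1.\<close>

lemma alternating_sum_Pow:
  assumes "finite A" "A \<noteq> {}"
  shows "(\<Sum>T \<in> Pow A. (- 1) ^ card T) = (0 :: real)"
proof -
  have "(if A = {} then 1 else 0 :: real) = (\<Sum>T \<in> Pow A. (- 1) ^ card T * 1)"
    by (rule inclusion_exclusion_symmetric[where f = "\<lambda>S. if S = {} then 1 else 0"])
      (simp_all add: assms if_distrib[of "\<lambda>z. _ * z"] cong: if_cong)
  with assms show ?thesis by simp
qed

text \<open>Otherwise \<open>h\<close> takes one value at \<open>y\<close> and the other on the rest
  of the cube. In the signed sum for the top coefficient the constant part cancels, and the one term
  left, at \<open>y\<close>, is nonzero.\<close>

lemma pdeg_less_imp_flip_invariant:
  assumes "pdeg n h < n" and y: "y \<in> cube n"
  obtains S where "S \<subseteq> {..<n}" "S \<noteq> {}" "h (flip_bits y S) = h y"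
proof (rule ccontr)
  assume "\<not> thesis"
  with that have neq: "h (flip_bits y S) \<noteq> h y" if "S \<subseteq> {..<n}" "S \<noteq> {}" for S
    using \<open>S \<subseteq> {..<n}\<close> \<open>S \<noteq> {}\<close> by blast
  define u where "u T = (map (\<lambda>i. of_bool (i \<in> T)) [0..<n] :: bit list)" for T
  define Y where "Y = {i. i < n \<and> y ! i = 1}"
  have len: "length y = n" using y by (simp add: cube_def)
  have uY: "u Y = y"
    using len by (intro nth_equalityI) (auto simp: u_def Y_def)
  \<comment> \<open>\<open>b\<close> is the value away from \<open>y\<close>, and \<open>e\<close>,
    which is 1 or -1, is the jump at \<open>y\<close>.\<close>
  define b where "b = (of_bit (h y + 1) :: real)"
  define e where "e = of_bit (h y) - b"
  have "e \<noteq> 0"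
    unfolding e_def b_def by (cases "h y") auto
  have val: "of_bit (h (u T)) = b + (if T = Y then e else 0)" if "T \<subseteq> {..<n}" for T
  proof (cases "T = Y")
    case True
    then show ?thesis by (simp add: uY e_def)
  next
    case False
    \<comment> \<open>The symmetric difference of \<open>T\<close> and \<open>Y\<close>: flipping it
      turns \<open>y\<close> into \<open>u T\<close>.\<close>
    define S where "S = {i \<in> {..<n}. (i \<in> T) \<noteq> (i \<in> Y)}"
    have "S \<noteq> {}" "S \<subseteq> {..<n}"
      using False that by (auto simp: S_def Y_def)
    moreover have "u T = flip_bits y S"
      using len by (intro nth_equalityI) (auto simp: u_def S_def Y_def)
    ultimately have "h (u T) = h y + 1"
      using neq[of S] bit_noteq_iff by metis
    with False show ?thesis by (simp add: b_def)
  qed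
  have Y: "Y \<subseteq> {..<n}" by (auto simp: Y_def)
  have "0 = (\<Sum>T \<in> Pow {..<n}. (- 1) ^ card T * of_bit (h (u T)) :: real)"
    using multilinear_rep_top_coeff[OF multilinear_rep_real_coeffs, of n h]
      real_coeffs_top_eq_0[OF assms(1)] by (simp add: u_def)
  also have "\<dots> = (\<Sum>T \<in> Pow {..<n}. (- 1) ^ card T * b + (if T = Y then (- 1) ^ card T * e else 0))"
    by (intro sum.cong refl) (simp only: Pow_iff val, simp add: distrib_left)
  also have "\<dots> = (\<Sum>T \<in> Pow {..<n}. (- 1) ^ card T) * b + (- 1) ^ card Y * e"
    using Y by (simp add: sum.distrib sum_distrib_right)
  also have "(\<Sum>T \<in> Pow {..<n}. (- 1) ^ card T) = (0 :: real)"
    \<comment> \<open>The degree bound forces n > 0, so \<open>{..<n}\<close> is nonempty.\<close>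
    using assms(1) by (intro alternating_sum_Pow) auto
  finally show False using \<open>e \<noteq> 0\<close> by simp
qed

text \<open>Index \<open>i * m\<close> is the first position of block \<open>i\<close>, so block
  \<open>j\<close> contains no other multiple of \<open>m\<close> than its own start.\<close>

lemma block_flip_block_starts:
  assumes "x \<in> cube (d * m)" "j < d" "0 < m"
  shows "block m (flip_bits x ((\<lambda>i. i * m) ` S)) j =
    flip_bits (block m x j) (if j \<in> S then {0} else {})"
proof (rule nth_equalityI)
  have "Suc j * m \<le> d * m" using assms(2) by (intro mult_le_mono1) simp
  then have le: "j * m + m \<le> length x" using assms(1) by (simp add: cube_def)
  then show "length (block m (flip_bits x ((\<lambda>i. i * m) ` S)) j) =
      length (flip_bits (block m x j) (if j \<in> S then {0} else {}))"
    by (simp add: block_def)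
  fix r assume "r < length (block m (flip_bits x ((\<lambda>i. i * m) ` S)) j)"
  then have r: "r < m" by (simp add: block_def)
  have "j * m + r \<in> (\<lambda>i. i * m) ` S \<longleftrightarrow> r = 0 \<and> j \<in> S"
  proof
    assume "j * m + r \<in> (\<lambda>i. i * m) ` S"
    then obtain i where i: "i \<in> S" "j * m + r = i * m" by auto
    have "r = (j * m + r) mod m" using r by simp
    also have "\<dots> = 0" by (simp add: i(2))
    finally show "r = 0 \<and> j \<in> S" using i assms(3) by simp
  qed auto
  then show "block m (flip_bits x ((\<lambda>i. i * m) ` S)) j ! r =
      flip_bits (block m x j) (if j \<in> S then {0} else {}) ! r"
    using r le by (simp add: block_def)
qed

lemma order_sensitive_composition_less:
  assumes sens: "order_sensitive (d * m) t F"
    and F: "\<And>x. x \<in> cube (d * m) \<Longrightarrow> F x = h (map (\<lambda>j. g j (block m x j)) [0..<d])"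
    and h: "pdeg d h < d" and m: "0 < m"
  shows "t < d"
proof (rule ccontr)
  assume "\<not> t < d"
  \<comment> \<open>\<open>h\<close> gives d > 0. Order 1 covers single starts, order d covers any
    set of starts.\<close>
  with h have t: "d \<le> t" "1 \<le> t" by auto
  obtain x where x: "x \<in> cube (d * m)" and
    flip: "\<And>S. S \<subseteq> {..<d * m} \<Longrightarrow> 1 \<le> card S \<Longrightarrow> card S \<le> t \<Longrightarrow> F x \<noteq> F (flip_bits x S)"
    using sens unfolding order_sensitive_def by blast
  define y where "y = map (\<lambda>j. g j (block m x j)) [0..<d]"
  define z where "z S = flip_bits x ((\<lambda>i. i * m) ` S)" for S
  have Fz: "F (z S) = h (map (\<lambda>j. g j (flip_bits (block m x j) (if j \<in> S then {0} else {}))) [0..<d])"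
    for S
  proof -
    have "z S \<in> cube (d * m)" using x by (simp add: z_def cube_def)
    then show ?thesis
      using x m by (auto simp: F z_def block_flip_block_starts intro!: arg_cong[where f = h])
  qed
  have starts: "F x \<noteq> F (z S)" if S: "S \<subseteq> {..<d}" "S \<noteq> {}" for S
  proof -
    have card: "card ((\<lambda>i. i * m) ` S) = card S"
      using m by (intro card_image) (auto simp: inj_on_def)
    have fin: "finite S" using S(1) finite_subset by blast
    have "(\<lambda>i. i * m) ` S \<subseteq> {..<d * m}" using S m by auto
    moreover have "1 \<le> card S" using S fin by (simp add: Suc_le_eq card_gt_0_iff)
    moreover have "card S \<le> t"
      using card_mono[OF finite_lessThan S(1)] t by simp
    ultimately show ?thesis unfolding z_def by (intro flip) (simp_all add: card)
  qed
  \<comment> \<open>If flipping one start left its block value unchanged, all arguments of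
    \<open>h\<close> and hence \<open>F x\<close> would stay the same.\<close>
  have change: "g j (flip_bits (block m x j) {0}) = g j (block m x j) + 1" if "j < d" for j
  proof (rule ccontr)
    assume "\<not> ?thesis"
    then have "g j (flip_bits (block m x j) {0}) = g j (block m x j)"
      using bit_noteq_iff by metis
    then have "F (z {j}) = F x"
      by (auto simp: Fz F[OF x] intro!: arg_cong[where f = h])
    with starts[of "{j}"] that show False by simp
  qed
  have "y \<in> cube d" by (simp add: y_def cube_def)
  then obtain S where S: "S \<subseteq> {..<d}" "S \<noteq> {}" "h (flip_bits y S) = h y"
    using pdeg_less_imp_flip_invariant[OF h] by blast
  \<comment> \<open>By \<open>change\<close>, flipping starts in \<open>x\<close> acts on the
    argument vector \<open>y\<close> as flipping the coordinates in \<open>S\<close>.\<close>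
  have "map (\<lambda>j. g j (flip_bits (block m x j) (if j \<in> S then {0} else {}))) [0..<d] = flip_bits y S"
    by (intro nth_equalityI) (auto simp: y_def change)
  then have "F (z S) = F x" using S(3) by (simp add: Fz F[OF x] y_def)
  with starts[OF S(1,2)] show False by simp
qed

theorem mainTheorem5:
  fixes d :: nat and f :: "nat \<Rightarrow> bit list \<Rightarrow> bit"
  assumes "iterated_composition d f"
    and "\<And>k. k \<ge> 1 \<Longrightarrow> pdeg (d ^ k) (f k) < d ^ k"
  shows "\<not> (\<exists>t :: nat \<Rightarrow> nat. filterlim t at_top at_top \<and> (d = 1 \<longrightarrow> t 1 \<noteq> 0) \<and>
               (\<forall>k \<ge> 1. order_sensitive (d ^ k) (t (d ^ k)) (f k)))"
proof
  assume "\<exists>t :: nat \<Rightarrow> nat. filterlim t at_top at_top \<and> (d = 1 \<longrightarrow> t 1 \<noteq> 0) \<and>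
               (\<forall>k \<ge> 1. order_sensitive (d ^ k) (t (d ^ k)) (f k))"
  then obtain t :: "nat \<Rightarrow> nat" where t: "filterlim t at_top at_top" "d = 1 \<longrightarrow> t 1 \<noteq> 0"
    and sens: "\<And>k. k \<ge> 1 \<Longrightarrow> order_sensitive (d ^ k) (t (d ^ k)) (f k)" by blast
  have h: "pdeg d (f 1) < d" using assms(2)[of 1] by simp
  have less: "t (d ^ k) < d" if k: "k \<ge> 2" for k
  proof -
    obtain g where g: "\<And>x. x \<in> cube (d ^ k) \<Longrightarrow>
        f k x = f 1 (map (\<lambda>j. g j (block (d ^ (k - 1)) x j)) [0..<d])"
      using assms(1) k unfolding iterated_composition_def by blast
    have dk: "d ^ k = d * d ^ (k - 1)" using k by (cases k) auto
    show ?thesis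
    proof (rule order_sensitive_composition_less)
      show "order_sensitive (d * d ^ (k - 1)) (t (d ^ k)) (f k)"
        using sens[of k] k unfolding dk[symmetric] by simp
      show "f k x = f 1 (map (\<lambda>j. g j (block (d ^ (k - 1)) x j)) [0..<d])"
        if "x \<in> cube (d * d ^ (k - 1))" for x
        using that unfolding dk[symmetric] by (rule g)
    qed (use h in auto)
  qed
  show False
  \<comment> \<open>For d = 1 every \<open>d ^ k\<close> is 1, so divergence of \<open>t\<close>
    says nothing; here \<open>less\<close> gives \<open>t 1 < 1\<close>.\<close>
  proof (cases "d = 1")
    case True
    with less[of 2] t(2) show False by simp
  next
    case False
    with h have d: "d \<ge> 2" by auto
    obtain N where N: "\<And>n. n \<ge> N \<Longrightarrow> t n \<ge> d"
      using t(1) unfolding filterlim_at_top eventually_at_top_linorder by blast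
    \<comment> \<open>The 2 makes \<open>less\<close> applicable; the \<open>N\<close> puts
      \<open>d ^ k > k\<close> beyond the threshold where \<open>t\<close> is at least d.\<close>
    define k where "k = max 2 N"
    have "k < d ^ k" using d by (intro power_gt_expt) simp
    then have "t (d ^ k) \<ge> d" by (intro N) (simp add: k_def)
    with less[of k] show False by (simp add: k_def)
  qed
qed

end
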